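(* Let $f_1,\ldots,f_m:\mathbb{R}^d\to\mathbb{R}$ be convex and differentiable, let $\gamma>0$ and $\rho=1/\gamma$. Suppose the sequences $\boldsymbol{x}_s^r,\boldsymbol{x}_i^r,\boldsymbol{\lambda}_{i|s}^r,\boldsymbol{\lambda}_{s|i}^r\in\mathbb{R}^d$ ($i=1,\ldots,m$) are generated by the PDMM iteration over the server-client network (defined in the context) with parameter $\rho$. Put $$\boldsymbol{z}_{i|s}^r=\boldsymbol{x}_i^r-\gamma\boldsymbol{\lambda}_{i|s}^r,\qquad \boldsymbol{z}_{s|i}^r=\boldsymbol{x}_s^r-\gamma\boldsymbol{\lambda}_{s|i}^r .$$ Then the sequences $\boldsymbol{x}_s^r,\boldsymbol{x}_i^r,\boldsymbol{z}_{i|s}^r,\boldsymbol{z}_{s|i}^r$ satisfy the FedSplit iteration (defined in the context) with parameter $\gamma$; that is, under this change of variables the PDMM update expressions are identical to those of FedSplit.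
   Context: PDMM iteration over the server-client network, parameter $\rho>0$: for each iteration $r$, and all $i=1,\ldots,m$, clients: $\boldsymbol{x}_i^{r+1}=\arg\min_{\boldsymbol{x}_i}\big[f_i(\boldsymbol{x}_i)+\frac{\rho}{2}\|\boldsymbol{x}_i-\boldsymbol{x}_s^r+\boldsymbol{\lambda}_{s|i}^r/\rho\|^2\big]$, $\ \boldsymbol{\lambda}_{i|s}^{r+1}=\rho(\boldsymbol{x}_s^r-\boldsymbol{x}_i^{r+1})-\boldsymbol{\lambda}_{s|i}^r$; server: $\boldsymbol{x}_s^{r+1}=\frac1m\sum_{i=1}^m(\boldsymbol{x}_i^{r+1}-\boldsymbol{\lambda}_{i|s}^{r+1}/\rho)$, $\ \boldsymbol{\lambda}_{s|i}^{r+1}=\rho(\boldsymbol{x}_i^{r+1}-\boldsymbol{x}_s^{r+1})-\boldsymbol{\lambda}_{i|s}^{r+1}$. FedSplit iteration, parameter $\gamma>0$: for each iteration $r$, and all $i=1,\ldots,m$, clients: $\boldsymbol{x}_i^{r+1}=\arg\min_{\boldsymbol{x}_i}\big[f_i(\boldsymbol{x}_i)+\frac{1}{2\gamma}\|\boldsymbol{x}_i-\boldsymbol{z}_{s|i}^r\|^2\big]$, $\ \boldsymbol{z}_{i|s}^{r+1}=2\boldsymbol{x}_i^{r+1}-\boldsymbol{z}_{s|i}^r$; server: $\boldsymbol{x}_s^{r+1}=\frac1m\sum_{i=1}^m\boldsymbol{z}_{i|s}^{r+1}$, $\ \boldsymbol{z}_{s|i}^{r+1}=2\boldsymbol{x}_s^{r+1}-\boldsymbol{z}_{i|s}^{r+1}$.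 *)

theory Defs
  imports "HOL-Analysis.Analysis"
begin

text \<open>
  Sequences are indexed by client \<open>i\<close> first and iteration \<open>r\<close> second; \<open>lam_cs i r\<close> and \<open>z_cs i r\<close>
  are the variables with subscript \<open>i|s\<close> (client to server), \<open>lam_sc i r\<close> and \<open>z_sc i r\<close> those with
  subscript \<open>s|i\<close> (server to client).  ``\<open>x = arg min g\<close>'' is rendered as \<open>x\<close> being a global minimiser
  of \<open>g\<close>; the objectives below are strictly convex whenever \<open>f i\<close> is convex and the parameter is
  positive, so such a minimiser is unique.
\<close>

definition pdmm_iteration ::
  "nat \<Rightarrow> (nat \<Rightarrow> real ^ 'd \<Rightarrow> real) \<Rightarrow> real \<Rightarrow> (nat \<Rightarrow> real ^ 'd) \<Rightarrow> (nat \<Rightarrow> nat \<Rightarrow> real ^ 'd)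
    \<Rightarrow> (nat \<Rightarrow> nat \<Rightarrow> real ^ 'd) \<Rightarrow> (nat \<Rightarrow> nat \<Rightarrow> real ^ 'd) \<Rightarrow> bool" where
  "pdmm_iteration m f \<rho> x_s x lam_cs lam_sc \<longleftrightarrow>
    (\<forall>r.
      (\<forall>i\<in>{1..m}.
        is_arg_min (\<lambda>y. f i y + \<rho> / 2 * (norm (y - x_s r + lam_sc i r /\<^sub>R \<rho>))\<^sup>2) (\<lambda>_. True)
          (x i (Suc r)) \<and>
        lam_cs i (Suc r) = \<rho> *\<^sub>R (x_s r - x i (Suc r)) - lam_sc i r) \<and>
      x_s (Suc r) = (1 / real m) *\<^sub>R (\<Sum>i=1..m. x i (Suc r) - lam_cs i (Suc r) /\<^sub>R \<rho>) \<and>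
      (\<forall>i\<in>{1..m}.
        lam_sc i (Suc r) = \<rho> *\<^sub>R (x i (Suc r) - x_s (Suc r)) - lam_cs i (Suc r)))"

definition fedsplit_iteration ::
  "nat \<Rightarrow> (nat \<Rightarrow> real ^ 'd \<Rightarrow> real) \<Rightarrow> real \<Rightarrow> (nat \<Rightarrow> real ^ 'd) \<Rightarrow> (nat \<Rightarrow> nat \<Rightarrow> real ^ 'd)
    \<Rightarrow> (nat \<Rightarrow> nat \<Rightarrow> real ^ 'd) \<Rightarrow> (nat \<Rightarrow> nat \<Rightarrow> real ^ 'd) \<Rightarrow> bool" where
  "fedsplit_iteration m f \<gamma> x_s x z_cs z_sc \<longleftrightarrow>
    (\<forall>r.
      (\<forall>i\<in>{1..m}.
        is_arg_min (\<lambda>y. f i y + 1 / (2 * \<gamma>) * (norm (y - z_sc i r))\<^sup>2) (\<lambda>_. True)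
          (x i (Suc r)) \<and>
        z_cs i (Suc r) = 2 *\<^sub>R x i (Suc r) - z_sc i r) \<and>
      x_s (Suc r) = (1 / real m) *\<^sub>R (\<Sum>i=1..m. z_cs i (Suc r)) \<and>
      (\<forall>i\<in>{1..m}.
        z_sc i (Suc r) = 2 *\<^sub>R x_s (Suc r) - z_cs i (Suc r)))"

end

theory Submission
  imports Defs
begin

text \<open>Since \<gamma> * \<rho> = 1, dividing a multiplier by \<rho> means scaling it by
  \<gamma>, so the new variables are exactly the combinations that PDMM itself uses. The centre of
  the client's proximal step is \<open>z_sc\<close>, the penalty weights agree, and the server
  averages the \<open>z_cs\<close>. Subtracting \<gamma> times a multiplier update from the matching
  primal variable turns it into a reflection, which is the FedSplit update.\<close>

theorem mainTheorem3:
  fixes m :: nat and f :: "nat \<Rightarrow> real ^ 'd \<Rightarrow> real" and \<gamma> \<rho> :: real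
    and x_s :: "nat \<Rightarrow> real ^ 'd"
    and x lam_cs lam_sc z_cs z_sc :: "nat \<Rightarrow> nat \<Rightarrow> real ^ 'd"
  assumes "m \<ge> 1"
    and "\<And>i. i \<in> {1..m} \<Longrightarrow> convex_on UNIV (f i)"
    and "\<And>i. i \<in> {1..m} \<Longrightarrow> f i differentiable_on UNIV"
    and "\<gamma> > 0"
    and "\<rho> = 1 / \<gamma>"
    and "pdmm_iteration m f \<rho> x_s x lam_cs lam_sc"
    and "\<And>i r. i \<in> {1..m} \<Longrightarrow> z_cs i r = x i r - \<gamma> *\<^sub>R lam_cs i r"
    and "\<And>i r. i \<in> {1..m} \<Longrightarrow> z_sc i r = x_s r - \<gamma> *\<^sub>R lam_sc i r"
  shows "fedsplit_iteration m f \<gamma> x_s x z_cs z_sc"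
proof -
  have \<gamma>\<rho>: "\<gamma> * \<rho> = 1" and inv_\<rho>: "inverse \<rho> = \<gamma>" and quot: "\<rho> / 2 = 1 / (2 * \<gamma>)"
    using \<open>\<gamma> > 0\<close> \<open>\<rho> = 1 / \<gamma>\<close> by simp_all
  have client: "is_arg_min (\<lambda>y. f i y + 1 / (2 * \<gamma>) * (norm (y - z_sc i r))\<^sup>2) (\<lambda>_. True)
        (x i (Suc r))"
    and z_cs_Suc: "z_cs i (Suc r) = 2 *\<^sub>R x i (Suc r) - z_sc i r"
    and z_sc_Suc: "z_sc i (Suc r) = 2 *\<^sub>R x_s (Suc r) - z_cs i (Suc r)"
    if i: "i \<in> {1..m}" for i r
  proof -
    note z_cs = assms(7)[OF i] and z_sc = assms(8)[OF i]
    have "is_arg_min (\<lambda>y. f i y + \<rho> / 2 * (norm (y - x_s r + lam_sc i r /\<^sub>R \<rho>))\<^sup>2) (\<lambda>_. True)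
        (x i (Suc r))"
      and lam_cs: "lam_cs i (Suc r) = \<rho> *\<^sub>R (x_s r - x i (Suc r)) - lam_sc i r"
      and lam_sc: "lam_sc i (Suc r) = \<rho> *\<^sub>R (x i (Suc r) - x_s (Suc r)) - lam_cs i (Suc r)"
      using assms(6) i unfolding pdmm_iteration_def by blast+
    \<comment> \<open>Holding for every \<open>y\<close>, this makes the two client objectives equal
      as functions, so the minimiser carries over directly.\<close>
    moreover have "y - x_s r + lam_sc i r /\<^sub>R \<rho> = y - z_sc i r" for y
      by (simp add: z_sc inv_\<rho>)
    ultimately show "is_arg_min (\<lambda>y. f i y + 1 / (2 * \<gamma>) * (norm (y - z_sc i r))\<^sup>2)
        (\<lambda>_. True) (x i (Suc r))"
      by (simp only: quot)
    \<comment> \<open>As \<gamma> * \<rho> = 1, the \<open>\<rho>\<close> term contributes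
      \<open>x i (Suc r) - x_s r\<close>: this doubles the client's iterate and leaves
      \<open>- x_s r + \<gamma> *\<^sub>R lam_sc i r\<close>, which is
      \<open>- z_sc i r\<close>.\<close>
    show "z_cs i (Suc r) = 2 *\<^sub>R x i (Suc r) - z_sc i r"
      unfolding z_cs z_sc lam_cs
      by (simp add: scaleR_diff_right \<gamma>\<rho> scaleR_2)
    \<comment> \<open>The same cancellation with client and server exchanged;
      \<open>lam_cs i (Suc r)\<close> is left unexpanded on both sides.\<close>
    show "z_sc i (Suc r) = 2 *\<^sub>R x_s (Suc r) - z_cs i (Suc r)"
      unfolding z_cs z_sc lam_sc
      by (simp add: scaleR_diff_right \<gamma>\<rho> scaleR_2)
  qed
  have "x_s (Suc r) = (1 / real m) *\<^sub>R (\<Sum>i=1..m. z_cs i (Suc r))" for r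
  proof -
    have "(\<Sum>i=1..m. x i (Suc r) - lam_cs i (Suc r) /\<^sub>R \<rho>) = (\<Sum>i=1..m. z_cs i (Suc r))"
      by (rule sum.cong) (simp_all add: assms(7) inv_\<rho>)
    then show ?thesis
      using assms(6) unfolding pdmm_iteration_def by metis
  qed
  then show ?thesis
    unfolding fedsplit_iteration_def using client z_cs_Suc z_sc_Suc by blast
qed

end
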